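(* Let $m$ and $r$ be odd integers, and let $\Omega_{m,r} : \mathbb{Z}_2 \to \mathbb{Z}_2$ be the autoconjugacy map of the generalized Collatz map $T_{m,r}$. Then for all $x \in \mathbb{Z}_2$ and all $n \in \mathbb{N}$, \[ \frac{r}{m-2} + \Omega_{m,r}(2^n x) = \Big(\frac{2}{m}\Big)^n \Big(\frac{r}{m-2} + \Omega_{m,r}(x)\Big), \] where the equality holds in $\mathbb{Z}_2$.
   Context: $\mathbb{Z}_2$ denotes the ring of 2-adic integers, and $\mathbb{N} = \{0,1,2,\ldots\}$. Every rational number with odd denominator is regarded as an element of $\mathbb{Z}_2$; in particular $m$ and $m-2$ are odd, hence units of $\mathbb{Z}_2$. For odd integers $m, r$, the generalized Collatz map $T_{m,r} : \mathbb{Z}_2 \to \mathbb{Z}_2$ is defined by $T_{m,r}(x) = x/2$ if $x \equiv 0 \pmod 2$, and $T_{m,r}(x) = (mx+r)/2$ if $x \equiv 1 \pmod 2$. Write $T_{m,r}^{(k)}$ for its $k$-th iterate ($T_{m,r}^{(0)}$ is the identity). The map $Q_{m,r} : \mathbb{Z}_2 \to \mathbb{Z}_2$ is defined by $Q_{m,r}(x) = \sum_{k \in \mathbb{N}} t_k 2^k$, where $t_k \in \{0,1\}$ and $t_k \equiv T_{m,r}^{(k)}(x) \pmod 2$. The map $Q_{m,r}$ is a continuous bijection of $\mathbb{Z}_2$ onto itself; write $\Phi_{m,r} = Q_{m,r}^{-1}$. Let $V : \mathbb{Z}_2 \to \mathbb{Z}_2$ be $V(x) = -1-x$. The autoconjugacy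 map is the composition $\Omega_{m,r} = \Phi_{m,r} \circ V \circ Q_{m,r}$. *)

theory Defs
  imports
    Complex_Main
    "HOL-Computational_Algebra.Factorial_Ring"
    "HOL-Number_Theory.Cong"
begin

section \<open>The ring of 2-adic integers\<close>

text \<open>
  The inverse limit of the rings $Z / 2^n Z$: a 2-adic integer is a coherent sequence of canonical
  representatives, the \<open>n\<close>-th of them, \<open>residue x n\<close>, lying in \<open>{0..<2 ^ n}\<close>.  The range
  condition is part of the coherence equation, since its right-hand side lies in that interval.
\<close>

typedef padic2 = "{f :: nat \<Rightarrow> int. \<forall>n. f n = f (Suc n) mod 2 ^ n}"
  morphisms residue Abs_padic2
  by (rule exI[of _ "\<lambda>_. 0"]) simp

lemma residue_Suc: "residue x (Suc n) mod 2 ^ n = residue x n"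
  by (rule residue[THEN CollectD, THEN spec, THEN sym])

lemma residue_mod [simp]: "residue x n mod 2 ^ n = residue x n"
proof -
  have "residue x (Suc n) mod 2 ^ n mod 2 ^ n = residue x (Suc n) mod 2 ^ n"
    by (rule mod_mod_trivial)
  then show ?thesis by (simp only: residue_Suc)
qed

lemma residue_at_0 [simp]: "residue x 0 = 0"
  using residue_mod[of x 0] by (simp del: residue_mod)

lemma residue_mod_le: "k \<le> n \<Longrightarrow> residue x n mod 2 ^ k = residue x k"
proof (induction n rule: dec_induct)
  case base
  show ?case by simp
next
  case (step n)
  have "residue x (Suc n) mod 2 ^ k = residue x (Suc n) mod 2 ^ n mod 2 ^ k"
    by (rule mod_mod_cancel[symmetric]) (simp add: le_imp_power_dvd step.hyps)
  then show ?case using step.IH by (simp add: residue_Suc)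
qed

lemma padic2_eqI: "(\<And>n. residue x n = residue y n) \<Longrightarrow> x = y"
  by (metis ext residue_inject)

lemma mod_mod_pow2_Suc: "(a mod 2 ^ Suc n) mod 2 ^ n = (a :: int) mod 2 ^ n"
  by (rule mod_mod_cancel) (simp add: le_imp_power_dvd)

lemma residue_Abs_mod:
  assumes "\<And>n. (f :: nat \<Rightarrow> int) (Suc n) mod 2 ^ n = f n mod 2 ^ n"
  shows "residue (Abs_padic2 (\<lambda>n. f n mod 2 ^ n)) n = f n mod 2 ^ n"
  using assms by (subst Abs_padic2_inverse) (auto simp: mod_mod_pow2_Suc simp del: power_Suc)

instantiation padic2 :: comm_ring_1
begin

definition "0 = Abs_padic2 (\<lambda>n. 0 mod 2 ^ n)"
definition "1 = Abs_padic2 (\<lambda>n. 1 mod 2 ^ n)"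
definition "x + y = Abs_padic2 (\<lambda>n. (residue x n + residue y n) mod 2 ^ n)"
definition "x - y = Abs_padic2 (\<lambda>n. (residue x n - residue y n) mod 2 ^ n)"
definition "- x = Abs_padic2 (\<lambda>n. (- residue x n) mod 2 ^ n)"
definition "x * y = Abs_padic2 (\<lambda>n. (residue x n * residue y n) mod 2 ^ n)"

lemma residue_0 [simp]: "residue 0 n = 0"
  unfolding zero_padic2_def by (subst residue_Abs_mod) auto

lemma residue_1: "residue 1 n = 1 mod 2 ^ n"
  unfolding one_padic2_def by (subst residue_Abs_mod) auto

lemma residue_add: "residue (x + y) n = (residue x n + residue y n) mod 2 ^ n"
  unfolding plus_padic2_def
  by (subst residue_Abs_mod) (auto simp: residue_Suc intro: mod_add_cong)

lemma residue_diff: "residue (x - y) n = (residue x n - residue y n) mod 2 ^ n"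
  unfolding minus_padic2_def
  by (subst residue_Abs_mod) (auto simp: residue_Suc intro: mod_diff_cong)

lemma residue_uminus: "residue (- x) n = (- residue x n) mod 2 ^ n"
  unfolding uminus_padic2_def
  by (subst residue_Abs_mod) (auto simp: residue_Suc intro: mod_minus_cong)

lemma residue_mult: "residue (x * y) n = (residue x n * residue y n) mod 2 ^ n"
  unfolding times_padic2_def
  by (subst residue_Abs_mod) (auto simp: residue_Suc intro: mod_mult_cong)

instance
proof
  fix a b c :: padic2
  show "a * b * c = a * (b * c)"
    by (rule padic2_eqI) (simp add: residue_mult mod_simps ac_simps)
  show "a * b = b * a"
    by (rule padic2_eqI) (simp add: residue_mult ac_simps)
  show "1 * a = a"
    by (rule padic2_eqI) (simp add: residue_mult residue_1 mod_simps)
  show "a + b + c = a + (b + c)"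
    by (rule padic2_eqI) (simp add: residue_add mod_simps ac_simps)
  show "a + b = b + a"
    by (rule padic2_eqI) (simp add: residue_add ac_simps)
  show "0 + a = a"
    by (rule padic2_eqI) (simp add: residue_add)
  show "- a + a = 0"
    by (rule padic2_eqI) (simp add: residue_add residue_uminus mod_simps)
  show "a - b = a + - b"
    by (rule padic2_eqI) (simp add: residue_add residue_diff residue_uminus mod_simps)
  show "(a + b) * c = a * c + b * c"
    by (rule padic2_eqI) (simp add: residue_add residue_mult mod_simps algebra_simps)
  show "(0 :: padic2) \<noteq> 1"
  proof
    assume "(0 :: padic2) = 1"
    then have "residue 0 1 = residue 1 1" by simp
    then show False by (simp add: residue_1)
  qed
qed

end

lemma residue_of_nat: "residue (of_nat k) n = int k mod 2 ^ n"
  by (induction k) (simp_all add: residue_add residue_1 mod_simps ac_simps)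

lemma residue_of_int: "residue (of_int k) n = k mod 2 ^ n"
  by (cases k rule: int_cases2) (simp_all add: residue_uminus residue_of_nat mod_simps)

lemma residue_numeral: "residue (numeral k) n = numeral k mod 2 ^ n"
  using residue_of_int[of "numeral k"] by simp

lemma residue_power: "residue (x ^ k) n = residue x n ^ k mod 2 ^ n"
  by (induction k) (simp_all add: residue_1 residue_mult mod_simps)

lemma pow2_dvd_padic2_iff: "2 ^ k dvd x \<longleftrightarrow> residue x k = 0" for x :: padic2
proof
  assume "2 ^ k dvd x"
  then obtain y where "x = 2 ^ k * y" ..
  then show "residue x k = 0"
    by (simp add: residue_mult residue_power residue_numeral mod_simps)
next
  assume *: "residue x k = 0"
  define f where "f n = residue x (n + k) div 2 ^ k" for n
  have mult_f: "2 ^ k * f n = residue x (n + k)" for n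
  proof -
    have "residue x (n + k) mod 2 ^ k = 0" using residue_mod_le[of k "n + k" x] * by simp
    then show ?thesis unfolding f_def by (metis mult_div_mod_eq add.right_neutral)
  qed
  have coh: "f (Suc n) mod 2 ^ n = f n mod 2 ^ n" for n
  proof -
    have "2 ^ k * f (Suc n) mod 2 ^ (n + k) = 2 ^ k * f n mod 2 ^ (n + k)"
      using residue_Suc[of x "n + k"] by (simp add: mult_f)
    then show ?thesis by (simp add: power_add mult.commute[of "2 ^ n"])
  qed
  have "x = 2 ^ k * Abs_padic2 (\<lambda>n. f n mod 2 ^ n)"
  proof (rule padic2_eqI)
    fix n
    have "residue (2 ^ k * Abs_padic2 (\<lambda>n. f n mod 2 ^ n)) n = 2 ^ k * f n mod 2 ^ n"
      by (simp add: residue_mult residue_power residue_numeral residue_Abs_mod[OF coh] mod_simps)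
    also have "\<dots> = residue x n"
      by (simp add: mult_f residue_mod_le)
    finally show "residue x n = residue (2 ^ k * Abs_padic2 (\<lambda>n. f n mod 2 ^ n)) n" ..
  qed
  then show "2 ^ k dvd x" by (rule dvdI)
qed

lemma padic2_nonzero_residue: "x \<noteq> 0 \<Longrightarrow> \<exists>n. residue x n \<noteq> 0"
  by (metis padic2_eqI residue_0)

lemma padic2_no_zero_divisors:
  fixes x y :: padic2
  assumes "x \<noteq> 0" "y \<noteq> 0"
  shows "x * y \<noteq> 0"
proof
  assume xy: "x * y = 0"
  obtain a b where ab: "residue x a \<noteq> 0" "residue y b \<noteq> 0"
    using assms padic2_nonzero_residue by metis
  define u v where "u = residue x (a + b)" and "v = residue y (a + b)"
  have "\<not> 2 ^ a dvd u" "\<not> 2 ^ b dvd v"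
    using ab residue_mod_le[of a "a + b" x] residue_mod_le[of b "a + b" y]
    by (auto simp: u_def v_def dvd_eq_mod_eq_0)
  then have "multiplicity 2 u < a" "multiplicity 2 v < b" "u \<noteq> 0" "v \<noteq> 0"
    by (auto intro: multiplicity_lessI simp flip: power_dvd_iff_le_multiplicity)
  then have "multiplicity 2 (u * v) < a + b"
    by (subst prime_elem_multiplicity_mult_distrib) auto
  then have "\<not> 2 ^ (a + b) dvd u * v"
    using \<open>u \<noteq> 0\<close> \<open>v \<noteq> 0\<close> by (subst power_dvd_iff_le_multiplicity) auto
  moreover have "residue (x * y) (a + b) = 0" using xy by simp
  ultimately show False by (simp add: residue_mult u_def v_def dvd_eq_mod_eq_0)
qed

text \<open>
  Division is exact division: \<open>x div y\<close> is the \<open>z\<close> with \<open>x = z * y\<close> if \<open>y \<noteq> 0\<close> divides \<open>x\<close>, and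
  the junk value 0 otherwise.
\<close>

instantiation padic2 :: idom_divide
begin

definition "x div y = (if y \<noteq> 0 \<and> y dvd x then THE z :: padic2. x = z * y else 0)"

instance
proof
  fix a b :: padic2
  show "a \<noteq> 0 \<Longrightarrow> b \<noteq> 0 \<Longrightarrow> a * b \<noteq> 0"
    by (rule padic2_no_zero_divisors)
  show "a * b div b = a" if "b \<noteq> 0"
  proof -
    have "z = a" if "a * b = z * b" for z
    proof -
      have "(a - z) * b = 0" using that by (simp add: left_diff_distrib)
      then show ?thesis using \<open>b \<noteq> 0\<close> padic2_no_zero_divisors[of "a - z" b] by auto
    qed
    then show ?thesis using that by (auto simp: divide_padic2_def intro!: the_equality)
  qed
  show "a div 0 = 0" by (simp add: divide_padic2_def)
qed

end

instance padic2 :: algebraic_semidom ..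

lemma two_dvd_padic2_iff: "2 dvd x \<longleftrightarrow> residue x 1 = 0" for x :: padic2
  using pow2_dvd_padic2_iff[of 1 x] by simp

lemma padic2_even_or_odd: "2 dvd x \<longleftrightarrow> \<not> 2 dvd (x - 1)" for x :: padic2
proof -
  have "residue x 1 = residue x 1 mod 2" using residue_mod[of x 1] by simp
  then have "residue x 1 = 0 \<or> residue x 1 = 1" by presburger
  then show ?thesis
    by (auto simp: two_dvd_padic2_iff residue_diff residue_1)
qed

text \<open>
  Together with exact division, this makes \<open>of_int a div of_int b\<close> with \<open>b\<close> odd the image of the
  rational number \<open>a / b\<close>.
\<close>

lemma odd_of_int_dvd_1:
  assumes "odd k"
  shows "(of_int k :: padic2) dvd 1"
proof -
  have "\<exists>u. [k * u = 1] (mod 2 ^ n)" for n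
    using assms by (intro cong_solve_coprime_int) simp
  then obtain f where f: "\<And>n. [k * f n = 1] (mod 2 ^ n)" by metis
  have coh: "f (Suc n) mod 2 ^ n = f n mod 2 ^ n" for n
  proof -
    have "[k * f (Suc n) = 1] (mod 2 ^ n)"
      using f[of "Suc n"] by (rule cong_dvd_modulus) (simp add: le_imp_power_dvd)
    then have "[k * f (Suc n) = k * f n] (mod 2 ^ n)"
      using f[of n] by (meson cong_sym cong_trans)
    then show ?thesis using assms by (simp add: cong_mult_lcancel cong_def[symmetric])
  qed
  have "1 = of_int k * Abs_padic2 (\<lambda>n. f n mod 2 ^ n)"
    using f
    by (intro padic2_eqI)
      (simp add: residue_1 residue_mult residue_of_int residue_Abs_mod[OF coh] mod_simps cong_def)
  then show ?thesis by (rule dvdI)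
qed

section \<open>The 2-adic topology\<close>

definition padic2_val :: "padic2 \<Rightarrow> nat"
  where "padic2_val x = (GREATEST n. 2 ^ n dvd x)"

lemma pow2_dvd_iff_le_val:
  fixes x :: padic2
  assumes "x \<noteq> 0"
  shows "2 ^ k dvd x \<longleftrightarrow> k \<le> padic2_val x"
proof -
  obtain n where n: "\<not> 2 ^ n dvd x"
    using assms padic2_nonzero_residue pow2_dvd_padic2_iff by blast
  have bound: "\<forall>k. 2 ^ k dvd x \<longrightarrow> k \<le> n"
    using n by (meson dvd_trans le_imp_power_dvd nat_le_linear)
  have "2 ^ padic2_val x dvd x"
    unfolding padic2_val_def by (rule GreatestI_nat[of _ 0 n]) (use bound in auto)
  moreover have "k \<le> padic2_val x" if "2 ^ k dvd x"
    unfolding padic2_val_def by (rule Greatest_le_nat[of _ k n]) (use that bound in auto)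
  ultimately show ?thesis by (meson dvd_trans le_imp_power_dvd)
qed

lemma padic2_val_minus: "padic2_val (- x) = padic2_val x"
  by (simp add: padic2_val_def)

instantiation padic2 :: metric_space
begin

definition dist_padic2 :: "padic2 \<Rightarrow> padic2 \<Rightarrow> real"
  where "dist x y = (if x = y then 0 else (1 / 2) ^ padic2_val (x - y))"

definition uniformity_padic2 :: "(padic2 \<times> padic2) filter"
  where "uniformity = (INF e\<in>{0 <..}. principal {(x :: padic2, y). dist x y < e})"

definition open_padic2 :: "padic2 set \<Rightarrow> bool"
  where "open (U :: padic2 set) \<longleftrightarrow> (\<forall>x\<in>U. \<forall>\<^sub>F (x', y) in uniformity. x' = x \<longrightarrow> y \<in> U)"

lemma dist_padic2_le_iff: "dist x y \<le> (1 / 2) ^ k \<longleftrightarrow> 2 ^ k dvd (x - y)" for x y :: padic2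
  by (auto simp: dist_padic2_def pow2_dvd_iff_le_val power_decreasing_iff)

lemma dist_padic2_commute: "dist x y = dist y x" for x y :: padic2
  unfolding dist_padic2_def by (metis minus_diff_eq padic2_val_minus)

instance
proof
  fix x y z :: padic2
  show "dist x y = 0 \<longleftrightarrow> x = y" by (simp add: dist_padic2_def)
  have "dist x y \<le> max (dist x z) (dist y z)"
  proof (cases "x = z \<or> y = z")
    case True
    then show ?thesis by (auto simp: dist_padic2_commute)
  next
    case False
    define k where "k = min (padic2_val (x - z)) (padic2_val (y - z))"
    have "2 ^ k dvd x - z" "2 ^ k dvd y - z"
      using False by (subst pow2_dvd_iff_le_val; simp add: k_def)+
    then have "2 ^ k dvd (x - z) - (y - z)" by (rule dvd_diff)
    then have "dist x y \<le> (1 / 2) ^ k" by (simp add: dist_padic2_le_iff)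
    also have "(1 / 2) ^ k = max (dist x z) (dist y z)"
      using False by (auto simp: dist_padic2_def k_def min_def max_def)
    finally show ?thesis .
  qed
  moreover have "dist x z \<ge> 0" "dist y z \<ge> 0" by (simp_all add: dist_padic2_def)
  ultimately show "dist x y \<le> dist x z + dist y z" by linarith
qed (simp_all add: uniformity_padic2_def open_padic2_def)

end

lemma pow2_dvd_diff_iff: "2 ^ n dvd x - y \<longleftrightarrow> residue x n = residue y n" for x y :: padic2
proof -
  have "2 ^ n dvd x - y \<longleftrightarrow> (residue x n - residue y n) mod 2 ^ n = 0"
    by (simp add: pow2_dvd_padic2_iff residue_diff)
  also have "\<dots> \<longleftrightarrow> residue x n mod 2 ^ n = residue y n mod 2 ^ n"
    by (simp only: mod_eq_dvd_iff dvd_eq_mod_eq_0)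
  finally show ?thesis by simp
qed

lemma padic2_eq_if_dvd_diff:
  fixes x y :: padic2
  assumes "\<And>n. 2 ^ n dvd x - y"
  shows "x = y"
  using assms by (intro padic2_eqI) (simp add: pow2_dvd_diff_iff)

lemma padic2_tendstoI:
  fixes X :: "nat \<Rightarrow> padic2"
  assumes "\<And>n N. n \<le> N \<Longrightarrow> 2 ^ n dvd X N - L"
  shows "X \<longlonglongrightarrow> L"
proof (rule metric_LIMSEQ_I)
  fix e :: real
  assume "e > 0"
  then obtain n where n: "(1 / 2) ^ n < e"
    using real_arch_pow_inv[of e "1 / 2"] by auto
  have "dist (X N) L < e" if "N \<ge> n" for N
    using assms[OF that] n by (simp flip: dist_padic2_le_iff)
  then show "\<exists>no. \<forall>N\<ge>no. dist (X N) L < e" by blast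
qed

lemma partial_sums_padic2_dvd:
  fixes c :: "nat \<Rightarrow> padic2"
  defines "S \<equiv> \<lambda>N. \<Sum>k<N. c k * 2 ^ k :: padic2"
  assumes "n \<le> N"
  shows "2 ^ n dvd S N - S n"
  using assms(2)
proof (induction N rule: dec_induct)
  case (step N)
  have "2 ^ n dvd (S N - S n) + c N * 2 ^ N"
    using step by (intro dvd_add dvd_mult) (auto simp: le_imp_power_dvd)
  then show ?case by (simp add: S_def algebra_simps)
qed simp

lemma summable_padic2_series: "summable (\<lambda>k. c k * 2 ^ k :: padic2)"
proof -
  define S :: "nat \<Rightarrow> padic2" where "S N = (\<Sum>k<N. c k * 2 ^ k)" for N
  have S: "2 ^ n dvd S N - S n" if "n \<le> N" for n N
    unfolding S_def using that by (rule partial_sums_padic2_dvd)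
  define L where "L = Abs_padic2 (\<lambda>n. residue (S n) n mod 2 ^ n)"
  have L: "residue L n = residue (S n) n" for n
    unfolding L_def
  proof (subst residue_Abs_mod)
    fix n
    show "residue (S (Suc n)) (Suc n) mod 2 ^ n = residue (S n) n mod 2 ^ n"
      using S[of n "Suc n"] by (simp add: residue_Suc pow2_dvd_diff_iff)
  qed simp
  have "S \<longlonglongrightarrow> L"
  proof (rule padic2_tendstoI)
    show "2 ^ n dvd S N - L" if "n \<le> N" for n N
      using S[OF that] by (simp add: pow2_dvd_diff_iff L)
  qed
  then show ?thesis by (auto simp: summable_def sums_def S_def[abs_def])
qed

lemma suminf_padic2_series_dvd:
  "2 ^ n dvd (\<Sum>k. c k * 2 ^ k) - (\<Sum>k<n. c k * 2 ^ k :: padic2)"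
proof -
  define S :: "nat \<Rightarrow> padic2" where "S N = (\<Sum>k<N. c k * 2 ^ k)" for N
  define L :: padic2 where "L = (\<Sum>k. c k * 2 ^ k)"
  have "S \<longlonglongrightarrow> L"
    unfolding S_def L_def using summable_sums[OF summable_padic2_series] by (simp add: sums_def)
  from metric_LIMSEQ_D[OF this, of "(1 / 2) ^ n"]
  obtain N0 where N0: "\<And>N. N \<ge> N0 \<Longrightarrow> dist (S N) L < (1 / 2) ^ n" by auto
  define N where "N = max N0 n"
  have "2 ^ n dvd S N - L"
    using N0[of N] by (simp add: N_def flip: dist_padic2_le_iff)
  moreover have "2 ^ n dvd S N - S n"
    unfolding S_def by (rule partial_sums_padic2_dvd) (simp add: N_def)
  ultimately have "2 ^ n dvd L - S n" by (simp add: pow2_dvd_diff_iff)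
  then show ?thesis by (simp add: L_def S_def)
qed

section \<open>The generalized Collatz map and its autoconjugacy\<close>

text \<open>
  The divisions by 2 are exact for odd \<open>m\<close> and \<open>r\<close>.
\<close>

definition collatz :: "int \<Rightarrow> int \<Rightarrow> padic2 \<Rightarrow> padic2"
  where "collatz m r x = (if 2 dvd x then x div 2 else (of_int m * x + of_int r) div 2)"

definition collatz_digit :: "int \<Rightarrow> int \<Rightarrow> padic2 \<Rightarrow> nat \<Rightarrow> padic2"
  where "collatz_digit m r x k = of_bool (\<not> 2 dvd (collatz m r ^^ k) x)"

definition Q_map :: "int \<Rightarrow> int \<Rightarrow> padic2 \<Rightarrow> padic2"
  where "Q_map m r x = (\<Sum>k. collatz_digit m r x k * 2 ^ k)"

definition Phi_map :: "int \<Rightarrow> int \<Rightarrow> padic2 \<Rightarrow> padic2"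
  where "Phi_map m r = inv (Q_map m r)"

definition V_map :: "padic2 \<Rightarrow> padic2"
  where "V_map x = - 1 - x"

definition Omega :: "int \<Rightarrow> int \<Rightarrow> padic2 \<Rightarrow> padic2"
  where "Omega m r = Phi_map m r \<circ> V_map \<circ> Q_map m r"

text \<open>
  Neither \<open>suminf\<close> nor \<open>inv\<close> is used outside its domain: the digit series converges, and
  \<^term>\<open>Q_map m r\<close> is a bijection for odd \<open>m\<close> and \<open>r\<close>.
\<close>

lemma summable_collatz_digit: "summable (\<lambda>k. collatz_digit m r x k * 2 ^ k)"
  by (rule summable_padic2_series)

lemma two_neq_zero_padic2 [simp]: "(2 :: padic2) \<noteq> 0"
proof
  assume "(2 :: padic2) = 0"
  then have "residue 2 2 = residue 0 2" by simp
  then show False by (simp add: residue_numeral)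
qed

lemma padic2_two_mult_power_dvd_iff: "2 ^ Suc n dvd 2 * x \<longleftrightarrow> 2 ^ n dvd x" for x :: padic2
  by (simp add: dvd_def mult.assoc)

lemma two_dvd_of_int:
  assumes "even k"
  shows "(2 :: padic2) dvd of_int k"
proof -
  from assms obtain j where "k = 2 * j" ..
  then show ?thesis by simp
qed

lemma two_collatz:
  assumes "odd m" "odd r"
  shows "2 * collatz m r x = (if 2 dvd x then x else of_int m * x + of_int r)"
proof -
  have "2 dvd of_int m * x + of_int r" if "\<not> 2 dvd x"
  proof -
    have "2 dvd x - 1" using that padic2_even_or_odd by blast
    then have "2 dvd of_int m * (x - 1)" by (rule dvd_mult)
    moreover have "(2 :: padic2) dvd of_int (m + r)" using assms by (intro two_dvd_of_int) simp
    ultimately have "2 dvd of_int m * (x - 1) + of_int (m + r)" by (rule dvd_add)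
    then show ?thesis by (simp add: algebra_simps)
  qed
  then show ?thesis by (simp add: collatz_def)
qed

lemma Q_map_unfold: "Q_map m r x = of_bool (\<not> 2 dvd x) + 2 * Q_map m r (collatz m r x)"
proof (rule padic2_eq_if_dvd_diff)
  fix n
  let ?S = "\<lambda>x n. \<Sum>k<n. collatz_digit m r x k * 2 ^ k"
  have dvd: "2 ^ n dvd Q_map m r x - ?S x n" for x n
    unfolding Q_map_def by (rule suminf_padic2_series_dvd)
  have "collatz_digit m r x (Suc k) = collatz_digit m r (collatz m r x) k" for k
    by (simp add: collatz_digit_def funpow_swap1)
  then have S: "?S x (Suc n) = of_bool (\<not> 2 dvd x) + 2 * ?S (collatz m r x) n"
    by (simp add: sum.lessThan_Suc_shift sum_distrib_left mult.left_commute del: sum.lessThan_Suc)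
      (simp add: collatz_digit_def)
  have "2 ^ Suc n dvd 2 * (Q_map m r (collatz m r x) - ?S (collatz m r x) n)"
    using dvd[of n "collatz m r x"] by (simp only: padic2_two_mult_power_dvd_iff)
  with dvd[of "Suc n" x]
  have "2 ^ Suc n dvd (Q_map m r x - ?S x (Suc n)) -
      2 * (Q_map m r (collatz m r x) - ?S (collatz m r x) n)"
    by (rule dvd_diff)
  then have "2 ^ Suc n dvd Q_map m r x - (of_bool (\<not> 2 dvd x) + 2 * Q_map m r (collatz m r x))"
    unfolding S by (simp add: algebra_simps)
  then show "2 ^ n dvd Q_map m r x - (of_bool (\<not> 2 dvd x) + 2 * Q_map m r (collatz m r x))"
    by (rule dvd_trans[rotated]) (simp add: le_imp_power_dvd)
qed

lemma two_dvd_Q_map_iff: "2 dvd Q_map m r x \<longleftrightarrow> 2 dvd x"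
proof -
  have "\<not> (2 :: padic2) dvd 1" by (simp add: two_dvd_padic2_iff residue_1)
  then show ?thesis
    by (subst Q_map_unfold) (auto simp: dvd_add_left_iff)
qed

lemma two_dvd_padic2_diff_iff: "2 dvd x - y \<longleftrightarrow> (2 dvd x \<longleftrightarrow> 2 dvd y)" for x y :: padic2
proof
  assume "2 dvd x - y"
  then show "2 dvd x \<longleftrightarrow> 2 dvd y" using pow2_dvd_diff_iff[of 1 x y] by (simp add: two_dvd_padic2_iff)
next
  assume *: "2 dvd x \<longleftrightarrow> 2 dvd y"
  then have "2 dvd x \<and> 2 dvd y \<or> 2 dvd x - 1 \<and> 2 dvd y - 1" using padic2_even_or_odd by blast
  then show "2 dvd x - y" using dvd_diff[of 2 x y] dvd_diff[of 2 "x - 1" "y - 1"] by auto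
qed

lemma Q_map_dvd_diff_iff:
  assumes "odd m" "odd r"
  shows "2 ^ n dvd Q_map m r x - Q_map m r y \<longleftrightarrow> 2 ^ n dvd x - y"
proof (induction n arbitrary: x y)
  case (Suc n)
  show ?case
  proof (cases "2 dvd x \<longleftrightarrow> 2 dvd y")
    case False
    have "\<not> 2 ^ Suc n dvd u - v" if "\<not> 2 dvd u - v" for u v :: padic2
      using that by (metis dvd_mult_left power_Suc)
    then show ?thesis using False by (simp add: two_dvd_padic2_diff_iff two_dvd_Q_map_iff del: power_Suc)
  next
    case True
    let ?T = "collatz m r"
    have "Q_map m r x - Q_map m r y = 2 * (Q_map m r (?T x) - Q_map m r (?T y))"
      using True by (subst (1 2) Q_map_unfold) (simp add: algebra_simps)
    then have "2 ^ Suc n dvd Q_map m r x - Q_map m r y \<longleftrightarrow> 2 ^ n dvd ?T x - ?T y"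
      by (simp only: padic2_two_mult_power_dvd_iff Suc.IH)
    also have "\<dots> \<longleftrightarrow> 2 ^ Suc n dvd 2 * ?T x - 2 * ?T y"
      by (simp only: padic2_two_mult_power_dvd_iff flip: right_diff_distrib)
    also have "\<dots> \<longleftrightarrow> 2 ^ Suc n dvd x - y"
    proof (cases "2 dvd x")
      case True
      then show ?thesis using \<open>2 dvd x \<longleftrightarrow> 2 dvd y\<close> by (simp only: two_collatz[OF assms] if_True)
    next
      case False
      then have "2 * ?T x - 2 * ?T y = of_int m * (x - y)"
        using \<open>2 dvd x \<longleftrightarrow> 2 dvd y\<close> by (simp add: two_collatz[OF assms] algebra_simps)
      then show ?thesis
        using odd_of_int_dvd_1[OF assms(1)] by (simp only: dvd_mult_unit_iff')
    qed
    finally show ?thesis .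
  qed
qed simp

lemma collatz_surj_parity:
  assumes "odd m" "odd r"
  shows "\<exists>x. (2 dvd x \<longleftrightarrow> b) \<and> collatz m r x = y"
proof (cases b)
  case True
  have "2 * collatz m r (2 * y) = 2 * y" by (simp add: two_collatz[OF assms])
  then show ?thesis using True by (intro exI[of _ "2 * y"]) simp
next
  case False
  obtain x where x: "2 * y - of_int r = of_int m * x"
    using odd_of_int_dvd_1[OF assms(1)] by (metis dvd_def unit_imp_dvd)
  have "\<not> 2 dvd x"
  proof
    assume "2 dvd x"
    then have "2 dvd 2 * y - of_int m * x" by (rule dvd_diff[OF dvd_triv_left dvd_mult])
    then have "(2 :: padic2) dvd of_int r" by (simp flip: x)
    then show False
      using assms(2) by (simp add: two_dvd_padic2_iff residue_of_int odd_iff_mod_2_eq_one)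
  qed
  moreover from this have "2 * collatz m r x = 2 * y"
    using x by (simp add: two_collatz[OF assms] flip: x)
  ultimately show ?thesis using False by auto
qed

lemma bij_Q_map:
  assumes "odd m" "odd r"
  shows "bij (Q_map m r)"
proof (rule bijI)
  show "inj (Q_map m r)"
  proof (rule injI)
    fix x y
    assume "Q_map m r x = Q_map m r y"
    then have "2 ^ n dvd x - y" for n by (simp flip: Q_map_dvd_diff_iff[OF assms])
    then show "x = y" by (rule padic2_eq_if_dvd_diff)
  qed
  have approx: "\<exists>x. 2 ^ n dvd Q_map m r x - q" for n q
  proof (induction n arbitrary: q)
    case (Suc n)
    have "2 dvd q - of_bool (\<not> 2 dvd q)" using padic2_even_or_odd[of q] by auto
    then obtain q' where q': "q - of_bool (\<not> 2 dvd q) = 2 * q'" ..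
    obtain y where y: "2 ^ n dvd Q_map m r y - q'" using Suc.IH by blast
    obtain x where x: "2 dvd x \<longleftrightarrow> 2 dvd q" "collatz m r x = y"
      using collatz_surj_parity[OF assms] by blast
    have "Q_map m r x - q = 2 * (Q_map m r y - q')"
      using q' x by (subst Q_map_unfold) (simp add: algebra_simps)
    then show ?case using y by (metis padic2_two_mult_power_dvd_iff)
  qed simp
  show "surj (Q_map m r)"
    unfolding surj_def
  proof
    fix q
    have "\<forall>n. \<exists>x. 2 ^ n dvd Q_map m r x - q" using approx by blast
    from choice[OF this] obtain X where X: "\<And>n. 2 ^ n dvd Q_map m r (X n) - q" by blast
    define x where "x = Abs_padic2 (\<lambda>n. residue (X n) n mod 2 ^ n)"
    have "residue x n = residue (X n) n" for n
      unfolding x_def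
    proof (subst residue_Abs_mod)
      fix n
      have "2 ^ n dvd Q_map m r (X (Suc n)) - q"
        using X[of "Suc n"] by (rule dvd_trans[rotated]) (simp add: le_imp_power_dvd)
      then have "2 ^ n dvd Q_map m r (X (Suc n)) - Q_map m r (X n)"
        using X[of n] by (simp add: pow2_dvd_diff_iff)
      then show "residue (X (Suc n)) (Suc n) mod 2 ^ n = residue (X n) n mod 2 ^ n"
        by (simp only: Q_map_dvd_diff_iff[OF assms] residue_Suc residue_mod pow2_dvd_diff_iff[symmetric])
    qed simp
    then have "2 ^ n dvd Q_map m r x - Q_map m r (X n)" for n
      by (simp only: Q_map_dvd_diff_iff[OF assms]) (simp only: pow2_dvd_diff_iff)
    then have "2 ^ n dvd Q_map m r x - q" for n
      using X[of n] by (simp add: pow2_dvd_diff_iff)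
    then have "Q_map m r x = q" by (rule padic2_eq_if_dvd_diff)
    then show "\<exists>x. q = Q_map m r x" by blast
  qed
qed

end

theory Submission
  imports Defs
begin

text \<open>
  The map \<open>Q\<close> reads off the parities along a trajectory, so doubling \<open>x\<close>, which prepends one
  even step to its trajectory, doubles \<open>Q x\<close>.  The complement \<open>V\<close> flips every parity, so the
  trajectory of \<open>\<Omega> (2 * x)\<close> is that of \<open>\<Omega> x\<close> with one odd step prepended.  This says
  that \<open>\<Omega> x = (m * \<Omega> (2 * x) + r) / 2\<close> (lemma \<open>Omega_double\<close>).

  Hence \<open>\<Omega> (2 * x)\<close> is obtained from \<open>\<Omega> x\<close> by the affine contraction
  \<open>y \<mapsto> (2 * y - r) / m\<close>.  Its slope is \<open>2 / m\<close> and its fixed point is \<open>- r / (m - 2)\<close>, so in the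
  coordinate centred at that point it is multiplication by \<open>2 / m\<close>.  Iterating it \<open>n\<close> times gives
  the claim.
\<close>

lemma padic2_div_odd_mult_self:
  assumes "odd k"
  shows "y div of_int k * of_int k = (y :: padic2)"
  by (rule dvd_div_mult_self[OF unit_imp_dvd[OF odd_of_int_dvd_1[OF assms]]])

lemma Q_map_Omega:
  assumes "odd m" "odd r"
  shows "Q_map m r (Omega m r x) = - 1 - Q_map m r x"
  using bij_is_surj[OF bij_Q_map[OF assms]]
  by (simp add: Omega_def Phi_map_def V_map_def surj_f_inv_f)

lemma Q_map_double: "Q_map m r (2 * x) = 2 * Q_map m r x"
  by (subst Q_map_unfold) (simp add: collatz_def)

text \<open>
  The digits of \<open>- 1 - 2 * Q x = 1 + 2 * (- 1 - Q x)\<close> are 1 followed by those of \<open>- 1 - Q x\<close>, so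
  \<open>\<Omega> (2 * x)\<close> is odd and its Collatz successor is \<open>\<Omega> x\<close>.
\<close>

lemma Omega_double:
  assumes "odd m" "odd r"
  shows "of_int m * Omega m r (2 * x) + of_int r = 2 * Omega m r x"
proof -
  define w where "w = Omega m r (2 * x)"
  have Qw: "Q_map m r w = 1 + 2 * (- 1 - Q_map m r x)"
    by (simp add: w_def Q_map_Omega[OF assms] Q_map_double)
  then have "2 dvd Q_map m r w - 1"
    by simp
  then have w_odd: "\<not> 2 dvd w"
    using padic2_even_or_odd two_dvd_Q_map_iff by blast
  \<comment> \<open>Strip the leading digit 1 on both sides; injectivity of \<open>Q\<close> then identifies the successor of
    \<open>w\<close>.\<close>
  have "1 + 2 * Q_map m r (collatz m r w) = 1 + 2 * Q_map m r (Omega m r x)"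
    using Qw w_odd Q_map_unfold[of m r w] by (simp add: Q_map_Omega[OF assms])
  then have "Q_map m r (collatz m r w) = Q_map m r (Omega m r x)"
    by simp
  then have "collatz m r w = Omega m r x"
    using bij_is_inj[OF bij_Q_map[OF assms]] by (simp add: inj_eq)
  then show ?thesis
    using two_collatz[OF assms, of w] w_odd by (simp add: w_def)
qed

text \<open>
  The affine recursion in the coordinate centred at its fixed point.  It is checked after
  multiplying by the unit \<open>m\<close>, where it reduces to
  \<open>m * r / (m - 2) - r = 2 * r / (m - 2)\<close>.
\<close>

lemma Omega_double_centred:
  assumes "odd m" "odd r"
  shows "of_int r div of_int (m - 2) + Omega m r (2 * x)
    = (2 div of_int m) * (of_int r div of_int (m - 2) + Omega m r x)"
proof -
  define c :: padic2 where "c = of_int r div of_int (m - 2)"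
  have "odd (m - 2)"
    using assms(1) by simp
  from padic2_div_odd_mult_self[OF this, of "of_int r"]
  have c: "c * (of_int m - 2) = of_int r"
    by (simp add: c_def)
  have "(c + Omega m r (2 * x)) * of_int m
      = c * (of_int m - 2) + 2 * c + of_int m * Omega m r (2 * x)"
    by (simp add: algebra_simps)
  also have "\<dots> = 2 * c + (of_int m * Omega m r (2 * x) + of_int r)"
    by (simp add: c)
  also have "\<dots> = (c + Omega m r x) * 2"
    unfolding Omega_double[OF assms] by (simp add: algebra_simps)
  also have "\<dots> = (c + Omega m r x) * (2 div of_int m) * of_int m"
    by (simp only: mult.assoc padic2_div_odd_mult_self[OF assms(1)])
  finally have "c + Omega m r (2 * x) = (c + Omega m r x) * (2 div of_int m)"
    using odd_of_int_dvd_1[OF assms(1)] by (metis unit_mult_right_cancel)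
  then show ?thesis
    by (simp only: c_def mult.commute)
qed

theorem theorem1:
  fixes m r :: int and x :: padic2 and n :: nat
  assumes "odd m" and "odd r"
  shows "of_int r div of_int (m - 2) + Omega m r (2 ^ n * x)
    = (2 div of_int m) ^ n * (of_int r div of_int (m - 2) + Omega m r x)"
proof (induction n)
  case (Suc n)
  then show ?case
    using Omega_double_centred[OF assms, of "2 ^ n * x"]
    by (simp only: power_Suc mult.assoc)
qed simp

end
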